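(* For every positive integer $N$, \[ \sum_{\substack{\pi\in\tilde{C}\\ |\pi|=N}} 2^{\nu_d(\pi)} \;=\; \sum_{\substack{\pi\in\mathcal{R}\\ |\pi|=N}} \mu(\pi), \] i.e. $\sum_{\pi\in\tilde{C}} 2^{\nu_d(\pi)}q^{|\pi|} = \sum_{\pi\in\mathcal{R}} \mu(\pi) q^{|\pi|}$ as formal power series.
   Context: A partition is a finite non-increasing sequence of positive integers (its parts); $|\pi|$ is the sum of its parts, $\nu_d(\pi)$ the number of distinct part sizes, and $f_i=f_i(\pi)$ the number of times $i$ occurs as a part (possibly $0$). $\tilde{C}$ is the set of non-empty partitions with no part divisible by $3$. $\mathcal{R}$ is the set of partitions $\pi$ for which there is an integer $n>0$ such that: (i) all parts of $\pi$ are $\le 2n-1$; (ii) every even integer $\le 2n-2$ is a part of $\pi$; (iii) $f_n\ge 1+\chi(n \text{ is even})$; (iv) no even part larger than $n$ occurs more than once. Such $n=n(\pi)$ is unique (it equals $1$ plus half the largest even part of $\pi$, or $1$ if $\pi$ has no even part). For $\pi\in\mathcal{R}$ with $n=n(\pi)$, set $\delta(\pi)=\sum_{j=1}^{n-1}\chi(f_{2j}>1)$, $\gamma(\pi)=\big(\chi(n\text{ is even})+2 f_n\chi(n\text{ is odd})\big)\prod_{j\ge 0,\ 2j+1<n}(2f_{2j+1}+1)$, and $\mu(\pi)=2^{\delta(\pi)}\gamma(\pi)$. Here $\chi(S)$ is $1$ if the statement $S$ is true and $0$ otherwise. *)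

theory Defs
  imports "HOL-Library.Multiset"
begin

text \<open>
  A partition is represented by the multiset of its parts. The number of occurrences \<open>f\<^sub>i\<close> of
  \<open>i\<close> in \<open>p\<close> is \<open>count p i\<close>, the weight \<open>|p|\<close> is \<open>sum_mset p\<close>, and the indicator
  \<open>\<chi>\<close> is \<open>of_bool\<close>.
\<close>

definition is_partition :: "nat multiset \<Rightarrow> bool" where
  "is_partition p \<longleftrightarrow> (\<forall>i \<in># p. i > 0)"

definition num_distinct :: "nat multiset \<Rightarrow> nat" where
  "num_distinct p = card (set_mset p)"

definition C_tilde :: "nat multiset set" where
  "C_tilde = {p. is_partition p \<and> p \<noteq> {#} \<and> (\<forall>i \<in># p. \<not> 3 dvd i)}"

definition R_index :: "nat multiset \<Rightarrow> nat \<Rightarrow> bool" where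
  "R_index p n \<longleftrightarrow>
     n > 0 \<and>
     (\<forall>i \<in># p. i \<le> 2 * n - 1) \<and>
     (\<forall>i. i > 0 \<and> even i \<and> i \<le> 2 * n - 2 \<longrightarrow> i \<in># p) \<and>
     count p n \<ge> 1 + of_bool (even n) \<and>
     (\<forall>i. even i \<and> i > n \<longrightarrow> count p i \<le> 1)"

definition R_set :: "nat multiset set" where
  "R_set = {p. is_partition p \<and> (\<exists>n. R_index p n)}"

definition n_of :: "nat multiset \<Rightarrow> nat" where
  "n_of p = (THE n. R_index p n)"

definition delta :: "nat multiset \<Rightarrow> nat" where
  "delta p = (\<Sum>j\<in>{1..<n_of p}. of_bool (count p (2 * j) > 1))"

definition gamma :: "nat multiset \<Rightarrow> nat" where
  "gamma p =
     (of_bool (even (n_of p)) + 2 * count p (n_of p) * of_bool (odd (n_of p))) *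
     (\<Prod>j\<in>{j. 2 * j + 1 < n_of p}. 2 * count p (2 * j + 1) + 1)"

definition mu :: "nat multiset \<Rightarrow> nat" where
  "mu p = 2 ^ delta p * gamma p"

lemma R_index_unique:
  assumes "R_index p m" and "R_index p n"
  shows "m = n"
proof -
  have le: "a \<le> b" if a: "R_index p a" and b: "R_index p b" for a b
  proof (rule ccontr)
    assume "\<not> a \<le> b"
    then have "b > 0" "2 * b > 0" "even (2 * b)" "2 * b \<le> 2 * a - 2"
      using b by (auto simp: R_index_def)
    then have "2 * b \<in># p"
      using a unfolding R_index_def by blast
    then have "2 * b \<le> 2 * b - 1"
      using b unfolding R_index_def by blast
    with \<open>b > 0\<close> show False by simp
  qed
  show ?thesis using le assms by (simp add: antisym)
qed

lemma n_of_eq: "R_index p n \<Longrightarrow> n_of p = n"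
  unfolding n_of_def by (blast intro: R_index_unique)

text \<open>The sums over partitions of fixed weight are over finite sets.\<close>

lemma finite_partitions: "finite {p. is_partition p \<and> sum_mset p = N}"
proof (rule finite_subset)
  show "{p. is_partition p \<and> sum_mset p = N} \<subseteq>
        mset ` {xs. set xs \<subseteq> {..N} \<and> length xs \<le> N}"
  proof
    fix p assume p: "p \<in> {p. is_partition p \<and> sum_mset p = N}"
    obtain xs where xs: "mset xs = p" using ex_mset by blast
    have pos: "\<forall>x\<in>set xs. x > 0" and s: "sum_list xs = N"
      using p xs by (auto simp: is_partition_def sum_mset_sum_list)
    have "length ys \<le> sum_list ys" if "\<forall>x\<in>set ys. x > 0" for ys :: "nat list"
      using that by (induction ys) auto
    with pos s have "length xs \<le> N" by blast
    moreover have "set xs \<subseteq> {..N}"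
      using s member_le_sum_list by fastforce
    ultimately show "p \<in> mset ` {xs. set xs \<subseteq> {..N} \<and> length xs \<le> N}"
      using xs by blast
  qed
  show "finite (mset ` {xs. set xs \<subseteq> {..N} \<and> length xs \<le> N})"
    by (simp add: finite_lists_length_le)
qed

end

theory Submission
  imports Defs "HOL-Computational_Algebra.Formal_Power_Series"
begin

text \<open>
  The elements of \<open>\<R>\<close> with \<open>n(\<pi>) = n\<close> have the generating function
  \<open>B\<^sub>n = q^(n\<^sup>2) (-1; q)\<^sub>n / ((q; q)\<^sub>n (q; q\<^sup>2)\<^sub>n)\<close>, so the claim is
  \<open>\<Sum>\<^sub>n B\<^sub>n = \<Prod> (1 + q\<^sup>i) / (1 - q\<^sup>i)\<close>, with \<open>i\<close> ranging over the numbers not divisible by \<open>3\<close>. A finite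
  form of the Jacobi triple product gives
  \<open>B\<^sub>n = q^(n\<^sup>2) \<Sum>\<^sub>r q^(r (r + 1) / 2) / ((q; q)\<^sub>n\<^sub>-\<^sub>r (q; q)\<^sub>n\<^sub>+\<^sub>r)\<close>. Summing over \<open>n\<close> first, a Durfee rectangle sum
  turns \<open>\<Sum>\<^sub>n B\<^sub>n\<close> into \<open>\<Sum>\<^sub>r q^(r (3 r + 1) / 2) / (q; q)\<^sub>\<infinity>\<close>, and the triple product with base
  \<open>q\<^sup>3\<close> evaluates this theta series. To avoid infinite products, everything is done modulo
  \<open>q^(N + 1)\<close> with products truncated far enough out.
\<close>

subsection \<open>A finite form of the Jacobi triple product\<close>

type_synonym ser = "rat fps"

abbreviation q :: ser where "q \<equiv> fps_X"

definition geo :: "nat \<Rightarrow> ser" where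
  "geo i = inverse (1 - q ^ i)"

lemma geo_cancel: "i > 0 \<Longrightarrow> geo i * (1 - q ^ i) = 1"
  unfolding geo_def by (rule inverse_mult_eq_1) simp

lemma eq_geo_multI:
  assumes "i > 0" and "f * (1 - q ^ i) = g"
  shows "f = g * geo i"
  using assms(2) geo_cancel[OF assms(1)] by (metis mult.assoc mult.commute mult.right_neutral)

text \<open>\<open>qfac_inv d k\<close> is \<open>1 / (q\<^sup>d; q\<^sup>d)\<^sub>k\<close>. Extending it by \<open>0\<close> to negative \<open>k\<close> makes the
  recurrence in \<open>k\<close> hold for all integers, so that bilateral sums need no boundary cases.\<close>

definition qfac_inv :: "nat \<Rightarrow> nat \<Rightarrow> ser" where
  "qfac_inv d k = (\<Prod>i<k. geo (d * Suc i))"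

definition qfac_inv_int :: "nat \<Rightarrow> int \<Rightarrow> ser" where
  "qfac_inv_int d k = (if k < 0 then 0 else qfac_inv d (nat k))"

lemma qfac_inv_0 [simp]: "qfac_inv d 0 = 1"
  by (simp add: qfac_inv_def)

lemma qfac_inv_Suc: "qfac_inv d (Suc k) = qfac_inv d k * geo (d * Suc k)"
  by (simp add: qfac_inv_def)

lemma qfac_inv_Suc': "d > 0 \<Longrightarrow> qfac_inv d (Suc k) * (1 - q ^ (d * Suc k)) = qfac_inv d k"
  by (simp add: qfac_inv_Suc mult.assoc geo_cancel del: mult_Suc_right)

lemma qfac_inv_int_step:
  assumes "d > 0"
  shows "qfac_inv_int d k * (1 - q ^ (d * nat k)) = qfac_inv_int d (k - 1)"
proof (cases "k > 0")
  case True
  then obtain j where "k = int (Suc j)"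
    by (metis zero_less_imp_eq_int gr0_conv_Suc)
  then show ?thesis
    using qfac_inv_Suc'[OF assms, of j] by (simp add: qfac_inv_int_def nat_add_distrib)
qed (auto simp: qfac_inv_int_def)

definition tri :: "int \<Rightarrow> nat" where
  "tri r = nat (r * (r + 1) div 2)"

lemma int_tri: "2 * int (tri r) = r * (r + 1)"
proof -
  have "r * (r + 1) \<ge> 0"
    by (cases "r \<ge> 0") (auto intro: mult_nonpos_nonpos)
  then show ?thesis by (simp add: tri_def)
qed

lemma tri_0 [simp]: "tri 0 = 0"
  by (simp add: tri_def)

lemma tri_step: "int (tri (r + 1)) = int (tri r) + r + 1"
  using int_tri[of r] int_tri[of "r + 1"] by (simp add: algebra_simps)

text \<open>Ramanujan's theta function f(a, b) has the terms a^(r (r + 1) / 2) b^(r (r - 1) / 2). In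
  these variables, unlike in z and 1/z, no negative power occurs, so everything stays in the ring of
  power series.\<close>

definition theta_term :: "ser \<Rightarrow> ser \<Rightarrow> int \<Rightarrow> ser" where
  "theta_term a b r = a ^ tri r * b ^ tri (- r)"

text \<open>Consecutive terms have the ratio a (ab)^r; clearing with (ab)^(m - r) avoids negative
  powers for r < 0.\<close>

lemma theta_term_step:
  assumes "r \<le> int m"
  shows "theta_term a b (r + 1) * (a * b) ^ nat (int m - r) = theta_term a b r * (a * (a * b) ^ m)"
proof -
  have "tri (r + 1) + nat (int m - r) = tri r + 1 + m"
    using assms tri_step[of r] by linarith
  moreover have "tri (- (r + 1)) + nat (int m - r) = tri (- r) + m"
  proof -
    have "int (tri (- r)) = int (tri (- (r + 1))) - r"
      using tri_step[of "- (r + 1)"] by simp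
    then show ?thesis using assms by linarith
  qed
  ultimately have "a ^ (tri (r + 1) + nat (int m - r)) * b ^ (tri (- (r + 1)) + nat (int m - r))
      = a ^ (tri r + 1 + m) * b ^ (tri (- r) + m)"
    by simp
  then show ?thesis
    by (simp only: theta_term_def power_add power_mult_distrib power_one_right mult_ac)
qed

text \<open>With Q = q^d, the two reciprocals are the Gaussian binomial of m + n over n + r divided
  by (Q; Q)_(m+n): a cut-off form of f(a, b).\<close>

definition theta_sum :: "nat \<Rightarrow> ser \<Rightarrow> ser \<Rightarrow> nat \<Rightarrow> nat \<Rightarrow> ser" where
  "theta_sum d a b m n =
     (\<Sum>r = - int n..int m. qfac_inv_int d (int n + r) * qfac_inv_int d (int m - r) * theta_term a b r)"

text \<open>This is the \<open>q\<close>-Pascal rule, from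
  \<open>1 - Q\<^sup>m\<^sup>+\<^sup>n\<^sup>+\<^sup>1 = (1 - Q\<^sup>m\<^sup>+\<^sup>1\<^sup>-\<^sup>r) + Q\<^sup>m\<^sup>+\<^sup>1\<^sup>-\<^sup>r (1 - Q\<^sup>n\<^sup>+\<^sup>r)\<close>, followed by the shift \<open>r \<mapsto> r + 1\<close> in the second
  sum.\<close>

lemma theta_sum_Suc:
  assumes d: "d > 0" and ab: "a * b = q ^ d"
  shows "theta_sum d a b (Suc m) n * (1 - q ^ (d * Suc (m + n)))
    = theta_sum d a b m n * (1 + a * q ^ (d * m))"
proof -
  let ?e = "qfac_inv_int d"
  let ?f = "theta_term a b"
  let ?Q = "\<lambda>k. q ^ (d * nat k)"
  have split: "?e (int n + r) * ?e (int (Suc m) - r) * ?f r * (1 - q ^ (d * Suc (m + n)))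
      = ?e (int n + r) * ?e (int m - r) * ?f r
        + ?e (int n + r - 1) * ?e (int (Suc m) - r) * (?f r * ?Q (int (Suc m) - r))"
    if r: "r \<in> {- int n..int (Suc m)}" for r
  proof -
    have "Suc (m + n) = nat (int (Suc m) - r) + nat (int n + r)"
      using r by auto
    then have "q ^ (d * Suc (m + n)) = ?Q (int (Suc m) - r) * ?Q (int n + r)"
      by (metis distrib_left power_add)
    then have "?e (int n + r) * ?e (int (Suc m) - r) * (1 - q ^ (d * Suc (m + n)))
      = ?e (int n + r) * (?e (int (Suc m) - r) * (1 - ?Q (int (Suc m) - r)))
        + (?e (int n + r) * (1 - ?Q (int n + r))) * ?e (int (Suc m) - r) * ?Q (int (Suc m) - r)"
      by (simp add: algebra_simps)
    also have "\<dots> = ?e (int n + r) * ?e (int m - r)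
        + ?e (int n + r - 1) * ?e (int (Suc m) - r) * ?Q (int (Suc m) - r)"
      unfolding qfac_inv_int_step[OF d] by simp
    finally have "?e (int n + r) * ?e (int (Suc m) - r) * (1 - q ^ (d * Suc (m + n))) * ?f r
      = (?e (int n + r) * ?e (int m - r)
        + ?e (int n + r - 1) * ?e (int (Suc m) - r) * ?Q (int (Suc m) - r)) * ?f r"
      by (rule arg_cong)
    then show ?thesis
      by (simp only: distrib_left distrib_right mult_ac)
  qed
  \<comment> \<open>Both boundary terms split off below vanish, since they contain
    \<open>qfac_inv_int\<close> at -1.\<close>
  have ins1: "{- int n..int (Suc m)} = insert (int (Suc m)) {- int n..int m}" by auto
  have ins2: "{- int n..int (Suc m)} = insert (- int n) {- int n + 1..int m + 1}" by auto
  have "theta_sum d a b (Suc m) n * (1 - q ^ (d * Suc (m + n)))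
      = (\<Sum>r = - int n..int (Suc m). ?e (int n + r) * ?e (int m - r) * ?f r)
        + (\<Sum>r = - int n..int (Suc m).
            ?e (int n + r - 1) * ?e (int (Suc m) - r) * (?f r * ?Q (int (Suc m) - r)))"
    unfolding theta_sum_def sum_distrib_right sum.distrib[symmetric]
    by (rule sum.cong[OF refl split])
  also have "(\<Sum>r = - int n..int (Suc m). ?e (int n + r) * ?e (int m - r) * ?f r)
      = theta_sum d a b m n"
    unfolding ins1 theta_sum_def by (subst sum.insert) (auto simp: qfac_inv_int_def)
  also have "(\<Sum>r = - int n..int (Suc m).
        ?e (int n + r - 1) * ?e (int (Suc m) - r) * (?f r * ?Q (int (Suc m) - r)))
      = (\<Sum>r = - int n + 1..int m + 1.
        ?e (int n + r - 1) * ?e (int (Suc m) - r) * (?f r * ?Q (int (Suc m) - r)))"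
    unfolding ins2 by (subst sum.insert) (auto simp: qfac_inv_int_def)
  also have "\<dots> = (\<Sum>r = - int n..int m.
        ?e (int n + r) * ?e (int m - r) * (?f (r + 1) * ?Q (int m - r)))"
    by (rule sum.reindex_bij_witness[of _ "\<lambda>r. r + 1" "\<lambda>r. r - 1"]) (auto simp: algebra_simps)
  also have "\<dots> = (\<Sum>r = - int n..int m.
        ?e (int n + r) * ?e (int m - r) * ?f r * (a * q ^ (d * m)))"
  proof (rule sum.cong[OF refl])
    fix r assume "r \<in> {- int n..int m}"
    then have "?f (r + 1) * ?Q (int m - r) = ?f r * (a * q ^ (d * m))"
      using theta_term_step[of r m a b] by (simp add: ab power_mult)
    then show "?e (int n + r) * ?e (int m - r) * (?f (r + 1) * ?Q (int m - r))
        = ?e (int n + r) * ?e (int m - r) * ?f r * (a * q ^ (d * m))"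
      by (simp add: mult.assoc)
  qed
  also have "\<dots> = theta_sum d a b m n * (a * q ^ (d * m))"
    unfolding theta_sum_def sum_distrib_right ..
  finally show ?thesis by (simp add: algebra_simps)
qed

lemma theta_sum_swap: "theta_sum d a b m n = theta_sum d b a n m"
  unfolding theta_sum_def
  by (rule sum.reindex_bij_witness[of _ uminus uminus]) (auto simp: theta_term_def algebra_simps)

text \<open>Each unit step in m contributes one factor in a. The start m = 0 is the mirror image,
  under r -> -r with a and b exchanged, of the case n = 0, so the same step also builds up the
  factors in b.\<close>

lemma finite_jacobi_triple:
  assumes d: "d > 0" and ab: "a * b = q ^ d"
  shows "theta_sum d a b m n
    = qfac_inv d (m + n) * (\<Prod>k<m. 1 + a * q ^ (d * k)) * (\<Prod>k<n. 1 + b * q ^ (d * k))"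
proof -
  have step: "theta_sum d x y (Suc m) n = theta_sum d x y m n * (1 + x * q ^ (d * m)) * geo (d * Suc (m + n))"
    if "x * y = q ^ d" for x y m n
    by (rule eq_geo_multI) (use d theta_sum_Suc[OF d that, of m n] in auto)
  have base: "theta_sum d x y m 0 = qfac_inv d m * (\<Prod>k<m. 1 + x * q ^ (d * k))"
    if xy: "x * y = q ^ d" for x y m
  proof (induction m)
    case 0
    then show ?case by (simp add: theta_sum_def qfac_inv_int_def theta_term_def)
  next
    case (Suc m)
    then show ?case using step[OF xy, of m 0]
      by (simp add: qfac_inv_Suc mult_ac)
  qed
  show ?thesis
  proof (induction m)
    case 0
    then show ?case
      using base[of b a n] ab by (subst theta_sum_swap) (simp add: mult.commute)
  next
    case (Suc m)
    then show ?case using step[OF ab, of m n]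
      by (simp add: qfac_inv_Suc mult_ac)
  qed
qed

subsection \<open>Congruence modulo a power of \<open>q\<close>, and Durfee sums\<close>

definition fps_cong :: "nat \<Rightarrow> ser \<Rightarrow> ser \<Rightarrow> bool" where
  "fps_cong K f g \<longleftrightarrow> q ^ K dvd f - g"

lemma fps_cong_refl [simp]: "fps_cong K f f"
  by (simp add: fps_cong_def)

lemma fps_cong_sym: "fps_cong K f g \<Longrightarrow> fps_cong K g f"
  unfolding fps_cong_def by (subst dvd_minus_iff[symmetric]) simp

lemma fps_cong_trans [trans]: "fps_cong K f g \<Longrightarrow> fps_cong K g h \<Longrightarrow> fps_cong K f h"
  using dvd_add[of "q ^ K" "f - g" "g - h"] by (simp add: fps_cong_def)

lemma fps_cong_mult: "fps_cong K f g \<Longrightarrow> fps_cong K f' g' \<Longrightarrow> fps_cong K (f * f') (g * g')"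
proof -
  assume "fps_cong K f g" "fps_cong K f' g'"
  then have "q ^ K dvd (f - g) * f' + g * (f' - g')"
    by (auto simp: fps_cong_def)
  then show ?thesis by (simp add: fps_cong_def algebra_simps)
qed

lemma fps_cong_sum: "(\<And>x. x \<in> A \<Longrightarrow> fps_cong K (f x) (g x)) \<Longrightarrow> fps_cong K (sum f A) (sum g A)"
  unfolding fps_cong_def by (simp add: dvd_sum flip: sum_subtractf)

lemma fps_cong_weaken: "fps_cong K f g \<Longrightarrow> L \<le> K \<Longrightarrow> fps_cong L f g"
  unfolding fps_cong_def by (meson dvd_trans le_imp_power_dvd)

text \<open>Multiplication by q^j gains j orders of accuracy. For large |r| the coefficients of the
  theta terms are known only to low order, and their high power of q makes up for it.\<close>

lemma fps_cong_shift: "fps_cong K f g \<Longrightarrow> L \<le> j + K \<Longrightarrow> fps_cong L (q ^ j * f) (q ^ j * g)"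
proof -
  assume "fps_cong K f g" and L: "L \<le> j + K"
  then have "q ^ j * q ^ K dvd q ^ j * (f - g)"
    unfolding fps_cong_def by (intro mult_dvd_mono) auto
  then have "fps_cong (j + K) (q ^ j * f) (q ^ j * g)"
    by (simp add: fps_cong_def algebra_simps power_add)
  then show ?thesis using L by (rule fps_cong_weaken)
qed

lemma fps_cong_nth: "fps_cong K f g \<Longrightarrow> i < K \<Longrightarrow> fps_nth f i = fps_nth g i"
proof -
  assume "fps_cong K f g" "i < K"
  then obtain h where "f - g = q ^ K * h" by (auto simp: fps_cong_def dvd_def)
  then have "fps_nth (f - g) i = 0" using \<open>i < K\<close> by (simp add: fps_X_power_mult_nth)
  then show ?thesis by simp
qed

lemma geo_cong_1: "i \<ge> K \<Longrightarrow> i > 0 \<Longrightarrow> fps_cong K (geo i) 1"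
proof -
  assume i: "i \<ge> K" "i > 0"
  have "geo i - 1 = geo i * q ^ i"
    using geo_cancel[OF i(2)] by (simp add: algebra_simps)
  then show ?thesis
    using i le_imp_power_dvd[of K i q] by (simp add: fps_cong_def)
qed

lemma qfac_inv_cong:
  assumes "d > 0" and "k \<le> L"
  shows "fps_cong (d * Suc k) (qfac_inv d L) (qfac_inv d k)"
  using \<open>k \<le> L\<close>
proof (induction L rule: dec_induct)
  case (step L)
  have "fps_cong (d * Suc k) (qfac_inv d L * geo (d * Suc L)) (qfac_inv d k * 1)"
    using step \<open>d > 0\<close> by (intro fps_cong_mult geo_cong_1) auto
  then show ?case by (simp add: qfac_inv_Suc)
qed simp

text \<open>As M grows this becomes the expansion of 1 / (q; q)_inf by Durfee rectangles of sides m
  and m + s.\<close>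

definition durfee_sum :: "nat \<Rightarrow> nat \<Rightarrow> ser" where
  "durfee_sum s M = (\<Sum>m\<le>M. q ^ (m * (m + s)) * qfac_inv 1 m * qfac_inv 1 (m + s))"

text \<open>Write \<open>S\<^sub>s\<close> for \<open>durfee_sum s\<close>. The \<open>m\<close>-th terms of \<open>S\<^sub>s\<close> and \<open>S\<^sub>s\<^sub>+\<^sub>1\<close> differ by \<open>a\<^sub>m - a\<^sub>m\<^sub>+\<^sub>1\<close> with
  \<open>a\<^sub>m = q^(m (m + s)) / ((q; q)\<^sub>m\<^sub>-\<^sub>1 (q; q)\<^sub>m\<^sub>+\<^sub>s)\<close>. So \<open>S\<^sub>s\<close> does not depend on \<open>s\<close> in the limit, and
  for large \<open>s\<close> only its term \<open>m = 0\<close> matters.\<close>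

lemma durfee_sum_telescope:
  "durfee_sum s M = durfee_sum (Suc s) M
     - q ^ (Suc M * (Suc M + s)) * qfac_inv 1 M * qfac_inv 1 (Suc M + s)"
proof (induction M)
  case 0
  have "qfac_inv 1 s = qfac_inv 1 (Suc s) * (1 - q ^ Suc s)"
    using qfac_inv_Suc'[of 1 s] by simp
  then show ?case by (simp add: durfee_sum_def right_diff_distrib mult.commute)
next
  case (Suc M)
  define E1 E2 where "E1 = qfac_inv 1 (Suc M)" and "E2 = qfac_inv 1 (Suc (Suc M + s))"
  define x w z where "x = q ^ Suc M" and "w = q ^ Suc (Suc M + s)" and "z = q ^ (Suc M * (Suc M + s))"
  have E: "qfac_inv 1 M = E1 * (1 - x)" "qfac_inv 1 (Suc M + s) = E2 * (1 - w)"
    using qfac_inv_Suc'[of 1 M] qfac_inv_Suc'[of 1 "Suc M + s"]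
    by (simp_all add: E1_def E2_def x_def w_def)
  have "Suc M * (Suc M + Suc s) = Suc M * (Suc M + s) + Suc M"
    and "Suc (Suc M) * (Suc (Suc M) + s) = Suc M * (Suc M + s) + Suc M + Suc (Suc M + s)"
    by (simp_all add: algebra_simps)
  then have pow: "q ^ (Suc M * (Suc M + Suc s)) = z * x"
      "q ^ (Suc (Suc M) * (Suc (Suc M) + s)) = z * x * w"
    by (simp_all only: x_def w_def z_def power_add)
  have "durfee_sum s (Suc M) = durfee_sum s M + z * E1 * qfac_inv 1 (Suc M + s)"
    by (simp add: durfee_sum_def z_def E1_def)
  also have "\<dots> = durfee_sum (Suc s) M - z * qfac_inv 1 M * qfac_inv 1 (Suc M + s)
      + z * E1 * qfac_inv 1 (Suc M + s)"
    using Suc.IH by (simp only: z_def)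
  \<comment> \<open>What remains is z x (1 - w) E1 E2: its first half is the new summand of
    \<open>durfee_sum (Suc s)\<close>, its second half the new boundary term.\<close>
  also have "\<dots> = durfee_sum (Suc s) M + z * x * E1 * E2 - z * x * w * E1 * E2"
    unfolding E by (simp add: algebra_simps)
  also have "\<dots> = durfee_sum (Suc s) (Suc M) - z * x * w * E1 * E2"
    unfolding durfee_sum_def sum.atMost_Suc pow by (simp add: E1_def E2_def)
  finally show ?case
    unfolding pow by (simp add: E1_def E2_def)
qed

lemma durfee_sum_cong:
  "fps_cong (Suc M * (Suc M + s)) (durfee_sum s M) (durfee_sum (s + t) M)"
proof (induction t)
  case (Suc t)
  have "q ^ (Suc M * (Suc M + s)) dvd q ^ (Suc M * (Suc M + (s + t)))"
    by (intro le_imp_power_dvd mult_le_mono2) simp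
  then have "fps_cong (Suc M * (Suc M + s)) (durfee_sum (s + t) M) (durfee_sum (Suc (s + t)) M)"
    unfolding durfee_sum_telescope[of "s + t"] fps_cong_def by (simp add: mult.assoc dvd_mult2)
  with Suc show ?case by (auto intro: fps_cong_trans)
qed simp

lemma durfee_sum_limit:
  assumes "K \<le> Suc M * (Suc M + s)" and "K \<le> Suc L"
  shows "fps_cong K (durfee_sum s M) (qfac_inv 1 L)"
proof -
  \<comment> \<open>At least s, to be reachable by raising the shift; at least K, so that the terms
    with m > 0 vanish modulo q^K; at least L, so that the last product can be truncated.\<close>
  let ?t = "K + L + s"
  have "fps_cong K (durfee_sum s M) (durfee_sum ?t M)"
    using durfee_sum_cong[of M s "K + L"] assms(1)
    by (auto intro: fps_cong_weaken simp: add_ac)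
  also have "fps_cong K (durfee_sum ?t M)
      (\<Sum>m\<le>M. if m = 0 then qfac_inv 1 ?t else 0)"
    unfolding durfee_sum_def
  proof (rule fps_cong_sum)
    fix m assume "m \<in> {..M}"
    show "fps_cong K (q ^ (m * (m + ?t)) * qfac_inv 1 m * qfac_inv 1 (m + ?t))
        (if m = 0 then qfac_inv 1 ?t else 0)"
    proof (cases m)
      case (Suc j)
      then have "K \<le> m * (m + ?t)" by simp
      then show ?thesis using Suc
        by (simp add: fps_cong_def mult.assoc dvd_mult2 le_imp_power_dvd del: power_Suc mult_Suc)
    qed simp
  qed
  also have "(\<Sum>m\<le>M. if m = 0 then qfac_inv 1 ?t else 0) = qfac_inv 1 ?t"
    by simp
  also have "fps_cong K (qfac_inv 1 ?t) (qfac_inv 1 L)"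
    using qfac_inv_cong[of 1 L ?t] assms(2) by (auto intro: fps_cong_weaken)
  finally show ?thesis .
qed

subsection \<open>The limiting Bailey argument\<close>

lemma qfac_inv_int_sym_mult:
  assumes "t = nat \<bar>r\<bar>"
  shows "qfac_inv_int d (int n + r) * qfac_inv_int d (int n - r)
    = (if t \<le> n then qfac_inv d (n - t) * qfac_inv d (n + t) else 0)"
proof (cases "r \<ge> 0")
  case True
  then have "r = int t" using assms by simp
  then show ?thesis
    by (auto simp: qfac_inv_int_def nat_add_distrib nat_diff_distrib mult.commute)
next
  case False
  then have "r = - int t" using assms by simp
  then show ?thesis
    by (auto simp: qfac_inv_int_def nat_add_distrib nat_diff_distrib mult.commute)
qed

lemma tri_add_tri_minus: "tri r + tri (- r) = nat \<bar>r\<bar> ^ 2"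
proof -
  have "int (tri r + tri (- r)) = r ^ 2"
    using int_tri[of r] int_tri[of "- r"] by (simp add: algebra_simps power2_eq_square)
  also have "\<dots> = int (nat \<bar>r\<bar> ^ 2)" by simp
  finally show ?thesis by presburger
qed

text \<open>With a = q and b = 1 the theta terms are q^(r (r + 1) / 2), so this is the bilateral
  form of B_n.\<close>

definition bailey_term :: "nat \<Rightarrow> ser" where
  "bailey_term n = q ^ n\<^sup>2 * theta_sum 1 q 1 n n"

text \<open>Only n >= t = |r| contribute, and n = m + t turns n^2 into t^2 + m (m + 2 t): a Durfee
  sum with shift 2 t. Keeping 3 N factors matches N factors in base q^3 later.\<close>

lemma inner_sum_cong:
  assumes r: "r \<in> {- int N..int N}"
  shows "fps_cong (Suc N)
    (\<Sum>n\<le>N. q ^ n\<^sup>2 * (qfac_inv_int 1 (int n + r) * qfac_inv_int 1 (int n - r)))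
    (q ^ (nat \<bar>r\<bar>)\<^sup>2 * qfac_inv 1 (3 * N))"
proof -
  define t where "t = nat \<bar>r\<bar>"
  have t: "t \<le> N" using r by (auto simp: t_def)
  have "(\<Sum>n\<le>N. q ^ n\<^sup>2 * (qfac_inv_int 1 (int n + r) * qfac_inv_int 1 (int n - r)))
      = (\<Sum>n\<in>{t..N}. q ^ n\<^sup>2 * (qfac_inv 1 (n - t) * qfac_inv 1 (n + t)))"
    unfolding qfac_inv_int_sym_mult[OF t_def]
    by (rule sum.mono_neutral_cong_right) auto
  also have "\<dots> = (\<Sum>m\<le>N - t. q ^ (m + t)\<^sup>2 * (qfac_inv 1 m * qfac_inv 1 (m + t + t)))"
    by (rule sum.reindex_bij_witness[of _ "\<lambda>m. m + t" "\<lambda>n. n - t"]) (use t in auto)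
  also have "\<dots> = q ^ t\<^sup>2 * durfee_sum (2 * t) (N - t)"
    unfolding durfee_sum_def sum_distrib_left
  proof (rule sum.cong[OF refl])
    fix m
    have "(m + t)\<^sup>2 = t\<^sup>2 + m * (m + 2 * t)"
      by (simp add: power2_eq_square algebra_simps)
    then show "q ^ (m + t)\<^sup>2 * (qfac_inv 1 m * qfac_inv 1 (m + t + t)) =
        q ^ t\<^sup>2 * (q ^ (m * (m + 2 * t)) * qfac_inv 1 m * qfac_inv 1 (m + 2 * t))"
      by (simp add: power_add mult.assoc mult_2 add.assoc)
  qed
  finally have eq: "(\<Sum>n\<le>N. q ^ n\<^sup>2 * (qfac_inv_int 1 (int n + r) * qfac_inv_int 1 (int n - r)))
      = q ^ t\<^sup>2 * durfee_sum (2 * t) (N - t)" .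
  have "Suc N \<le> Suc (N - t) + 2 * t" using t by simp
  also have "\<dots> \<le> Suc (N - t) * (Suc (N - t) + 2 * t)" by simp
  finally have "fps_cong (Suc N) (durfee_sum (2 * t) (N - t)) (qfac_inv 1 (3 * N))"
    by (rule durfee_sum_limit) simp
  then show ?thesis
    unfolding eq t_def[symmetric] by (rule fps_cong_shift) simp
qed

definition theta_partial :: "nat \<Rightarrow> ser" where
  "theta_partial N = (\<Sum>r = - int N..int N. theta_term (q ^ 2) q r)"

text \<open>Both exponents equal r (3 r + 1) / 2. The choice a = q^2, b = q has ab = q^3, which is
  where the modulus 3 comes from.\<close>

lemma theta_term_q2_q: "theta_term (q ^ 2) q r = q ^ tri r * q ^ (nat \<bar>r\<bar>)\<^sup>2"
proof -
  have "2 * tri r + tri (- r) = tri r + (nat \<bar>r\<bar>)\<^sup>2"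
    using tri_add_tri_minus[of r] by simp
  then show ?thesis
    by (simp only: theta_term_def power_mult[symmetric] power_add[symmetric])
qed

text \<open>The sum over n is moved inside. To this end the range of r is made independent of n; the
  added terms with |r| > n are 0 by the convention for \<open>qfac_inv_int\<close>.\<close>

lemma sum_bailey_term_cong:
  "fps_cong (Suc N) (\<Sum>n\<le>N. bailey_term n) (theta_partial N * qfac_inv 1 (3 * N))"
proof -
  let ?e = "\<lambda>n r. qfac_inv_int 1 (int n + r) * qfac_inv_int 1 (int n - r)"
  have "(\<Sum>n\<le>N. bailey_term n) = (\<Sum>n\<le>N. \<Sum>r = - int N..int N. q ^ tri r * (q ^ n\<^sup>2 * ?e n r))"
  proof (rule sum.cong[OF refl])
    fix n assume n: "n \<in> {..N}"
    have "theta_sum 1 q 1 n n = (\<Sum>r = - int n..int n. ?e n r * q ^ tri r)"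
      by (simp add: theta_sum_def theta_term_def)
    also have "\<dots> = (\<Sum>r = - int N..int N. ?e n r * q ^ tri r)"
      by (rule sum.mono_neutral_left) (use n in \<open>auto simp: qfac_inv_int_def\<close>)
    finally show "bailey_term n = (\<Sum>r = - int N..int N. q ^ tri r * (q ^ n\<^sup>2 * ?e n r))"
      by (simp add: bailey_term_def sum_distrib_left mult_ac)
  qed
  also have "\<dots> = (\<Sum>r = - int N..int N. q ^ tri r * (\<Sum>n\<le>N. q ^ n\<^sup>2 * ?e n r))"
    unfolding sum_distrib_left by (rule sum.swap)
  also have "fps_cong (Suc N) \<dots>
      (\<Sum>r = - int N..int N. q ^ tri r * (q ^ (nat \<bar>r\<bar>)\<^sup>2 * qfac_inv 1 (3 * N)))"
    by (intro fps_cong_sum fps_cong_mult fps_cong_refl inner_sum_cong)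
  also have "(\<Sum>r = - int N..int N. q ^ tri r * (q ^ (nat \<bar>r\<bar>)\<^sup>2 * qfac_inv 1 (3 * N)))
      = theta_partial N * qfac_inv 1 (3 * N)"
    by (simp add: theta_partial_def theta_term_q2_q sum_distrib_right mult.assoc)
  finally show ?thesis .
qed

section \<open>Product form of the theta series, by the triple product in base q^3\<close>

lemma theta_sum_cong_theta_partial:
  "fps_cong (Suc N) (theta_sum 3 (q ^ 2) q N N) (theta_partial N * (qfac_inv 3 N * qfac_inv 3 N))"
  unfolding theta_sum_def theta_partial_def sum_distrib_right
proof (rule fps_cong_sum)
  fix r assume "r \<in> {- int N..int N}"
  define t where "t = nat \<bar>r\<bar>"
  have t: "t \<le> N" using \<open>r \<in> _\<close> by (auto simp: t_def)
  \<comment> \<open>Agreement is guaranteed only to order 3 (N - t + 1), which is little for large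
    t; the factor q^(t^2) of the theta term compensates.\<close>
  have "fps_cong (3 * Suc (N - t)) (qfac_inv 3 (N - t) * qfac_inv 3 (N + t))
      (qfac_inv 3 N * qfac_inv 3 N)"
  proof (rule fps_cong_mult)
    show "fps_cong (3 * Suc (N - t)) (qfac_inv 3 (N - t)) (qfac_inv 3 N)"
      using qfac_inv_cong[of 3 "N - t" N] by (auto intro: fps_cong_sym)
    show "fps_cong (3 * Suc (N - t)) (qfac_inv 3 (N + t)) (qfac_inv 3 N)"
      using qfac_inv_cong[of 3 N "N + t"] by (auto intro: fps_cong_weaken)
  qed
  moreover have "Suc N \<le> t\<^sup>2 + 3 * Suc (N - t)"
  proof -
    \<comment> \<open>This is (t - 1) (t - 2) >= 0.\<close>
    have "3 * t \<le> t\<^sup>2 + 2"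
    proof (cases "t < 3")
      case True
      then have "t = 0 \<or> t = 1 \<or> t = 2" by auto
      then show ?thesis by auto
    next
      case False
      then have "3 * t \<le> t * t" by (intro mult_le_mono1) simp
      then show ?thesis unfolding power2_eq_square by linarith
    qed
    then show ?thesis using t by simp
  qed
  ultimately have "fps_cong (Suc N) (q ^ t\<^sup>2 * (qfac_inv 3 (N - t) * qfac_inv 3 (N + t)))
      (q ^ t\<^sup>2 * (qfac_inv 3 N * qfac_inv 3 N))"
    by (rule fps_cong_shift)
  then have "fps_cong (Suc N) (q ^ tri r * (q ^ t\<^sup>2 * (qfac_inv 3 (N - t) * qfac_inv 3 (N + t))))
      (q ^ tri r * (q ^ t\<^sup>2 * (qfac_inv 3 N * qfac_inv 3 N)))"
    by (rule fps_cong_mult[OF fps_cong_refl])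
  then show "fps_cong (Suc N)
      (qfac_inv_int 3 (int N + r) * qfac_inv_int 3 (int N - r) * theta_term (q ^ 2) q r)
      (theta_term (q ^ 2) q r * (qfac_inv 3 N * qfac_inv 3 N))"
    using t by (simp add: qfac_inv_int_sym_mult[OF t_def] theta_term_q2_q flip: t_def)
      (simp add: mult_ac)
qed

lemma qfac_inv_cancel: "d > 0 \<Longrightarrow> qfac_inv d k * (\<Prod>i<k. 1 - q ^ (d * Suc i)) = 1"
  unfolding qfac_inv_def prod.distrib[symmetric] by (intro prod.neutral) (simp add: geo_cancel)

text \<open>Multiplying the comparison with \<open>theta_sum\<close> by P^2 clears the squared
  denominator (q^3; q^3)_N. One P then cancels against the prefactor of the triple product,
  truncated from 2 N to N factors; the other P stays.\<close>

lemma theta_partial_cong: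
  "fps_cong (Suc N) (theta_partial N)
    ((\<Prod>k<N. 1 + q ^ (3 * k + 1)) * (\<Prod>k<N. 1 + q ^ (3 * k + 2)) * (\<Prod>i<N. 1 - q ^ (3 * Suc i)))"
proof -
  define P where "P = (\<Prod>i<N. 1 - q ^ (3 * Suc i))"
  define R where "R = (\<Prod>k<N. 1 + q ^ (3 * k + 1)) * (\<Prod>k<N. 1 + q ^ (3 * k + 2))"
  have P: "qfac_inv 3 N * P = 1"
    unfolding P_def by (rule qfac_inv_cancel) simp
  have "q ^ 2 * q = q ^ 3"
    by (simp add: power3_eq_cube power2_eq_square)
  from finite_jacobi_triple[OF _ this, of N N]
  have "theta_sum 3 (q ^ 2) q N N = qfac_inv 3 (N + N)
      * (\<Prod>k<N. 1 + q ^ 2 * q ^ (3 * k)) * (\<Prod>k<N. 1 + q * q ^ (3 * k))"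
    by simp
  also have "\<dots> = qfac_inv 3 (N + N) * R"
    by (simp add: R_def mult_ac flip: power_add)
  finally have jtp: "theta_sum 3 (q ^ 2) q N N = qfac_inv 3 (N + N) * R" .
  have "theta_partial N = theta_partial N * (qfac_inv 3 N * qfac_inv 3 N) * (P * P)"
    using P by (metis mult.assoc mult.commute mult.right_neutral)
  also have "fps_cong (Suc N) \<dots> (theta_sum 3 (q ^ 2) q N N * (P * P))"
    by (intro fps_cong_mult fps_cong_refl fps_cong_sym[OF theta_sum_cong_theta_partial])
  also have "fps_cong (Suc N) \<dots> (qfac_inv 3 N * R * (P * P))"
    unfolding jtp
    by (intro fps_cong_mult fps_cong_refl fps_cong_weaken[OF qfac_inv_cong]) auto
  also have "qfac_inv 3 N * R * (P * P) = R * P * (qfac_inv 3 N * P)"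
    by (simp only: mult_ac)
  finally show ?thesis unfolding P by (simp only: P_def R_def mult_1_right)
qed

text \<open>For 3 not dividing i this is 1 + 2 q^i + 2 q^(2 i) + ...: a factor 2 for each size
  present, as in 2^nu_d.\<close>

definition overpartition_factor :: "nat \<Rightarrow> ser" where
  "overpartition_factor i = (if 3 dvd i then 1 else (1 + q ^ i) * geo i)"

text \<open>From N to N + 1 the denominators for 3 N + 1, 3 N + 2, 3 N + 3 are added. The last
  cancels against 1 - q^(3 N + 3); the others join the two new numerators.\<close>

lemma theta_product_eq:
  "(\<Prod>k<N. 1 + q ^ (3 * k + 1)) * (\<Prod>k<N. 1 + q ^ (3 * k + 2)) * (\<Prod>i<N. 1 - q ^ (3 * Suc i))
      * qfac_inv 1 (3 * N) = (\<Prod>i=1..3 * N. overpartition_factor i)"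
proof (induction N)
  case (Suc N)
  define g1 g2 g3 where "g1 = geo (3 * N + 1)" and "g2 = geo (3 * N + 2)" and "g3 = geo (3 * N + 3)"
  have g3: "g3 * (1 - q ^ (3 * N + 3)) = 1"
    unfolding g3_def by (rule geo_cancel) simp
  have three: "3 * Suc N = Suc (Suc (Suc (3 * N)))" by simp
  have E: "qfac_inv 1 (3 * Suc N) = qfac_inv 1 (3 * N) * (g1 * g2 * g3)"
    unfolding three qfac_inv_Suc by (simp add: g1_def g2_def g3_def mult.assoc numeral_3_eq_3)
  have "\<not> 3 dvd Suc (3 * N)" "\<not> 3 dvd Suc (Suc (3 * N))" "3 dvd Suc (Suc (Suc (3 * N)))"
    by presburger+
  then have F: "(\<Prod>i=1..3 * Suc N. overpartition_factor i) = (\<Prod>i=1..3 * N. overpartition_factor i)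
      * (((1 + q ^ (3 * N + 1)) * g1) * ((1 + q ^ (3 * N + 2)) * g2))"
    unfolding three
    by (simp add: overpartition_factor_def g1_def g2_def mult.assoc del: power_Suc)
  have "(\<Prod>k<Suc N. 1 + q ^ (3 * k + 1)) * (\<Prod>k<Suc N. 1 + q ^ (3 * k + 2))
      * (\<Prod>i<Suc N. 1 - q ^ (3 * Suc i)) * qfac_inv 1 (3 * Suc N)
    = ((\<Prod>k<N. 1 + q ^ (3 * k + 1)) * (\<Prod>k<N. 1 + q ^ (3 * k + 2)) * (\<Prod>i<N. 1 - q ^ (3 * Suc i))
      * qfac_inv 1 (3 * N))
      * (((1 + q ^ (3 * N + 1)) * g1) * ((1 + q ^ (3 * N + 2)) * g2)) * (g3 * (1 - q ^ (3 * N + 3)))"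
  proof -
    have "3 * Suc N = 3 * N + 3" by simp
    then show ?thesis
      unfolding E prod.lessThan_Suc by (simp only: mult_ac)
  qed
  then show ?case unfolding Suc.IH F g3 by simp
qed simp

lemma sum_bailey_term_cong_product:
  "fps_cong (Suc N) (\<Sum>n\<le>N. bailey_term n) (\<Prod>i=1..3 * N. overpartition_factor i)"
proof -
  note sum_bailey_term_cong
  also have "fps_cong (Suc N) (theta_partial N * qfac_inv 1 (3 * N))
      (\<Prod>i=1..3 * N. overpartition_factor i)"
    unfolding theta_product_eq[symmetric]
    by (intro fps_cong_mult fps_cong_refl theta_partial_cong)
  finally show ?thesis .
qed

subsection \<open>Multisets with multiplicative weights\<close>

definition part_series :: "(nat \<Rightarrow> rat) \<Rightarrow> nat \<Rightarrow> ser" where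
  "part_series w i = Abs_fps (\<lambda>k. if i dvd k then w (k div i) else 0)"

text \<open>Multiplying by 1 - q^i takes backward differences of the weight. Most series below are
  evaluated by differencing until the weight has finite support or is known.\<close>

lemma part_series_mult:
  assumes i: "i > 0"
  shows "part_series w i * (1 - q ^ i) = part_series (\<lambda>f. w f - (if f = 0 then 0 else w (f - 1))) i"
proof (rule fps_ext)
  fix k
  have "fps_nth (part_series w i * (1 - q ^ i)) k
      = fps_nth (part_series w i) k - (if k < i then 0 else fps_nth (part_series w i) (k - i))"
    by (simp add: right_diff_distrib fps_X_power_mult_right_nth)
  also have "\<dots> = fps_nth (part_series (\<lambda>f. w f - (if f = 0 then 0 else w (f - 1))) i) k"
  proof (cases "i dvd k")
    case True
    then obtain c where "k = i * c" by blast
    then show ?thesis using i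
      by (cases c) (auto simp: part_series_def)
  next
    case False
    then show ?thesis
      by (auto simp: part_series_def dvd_minus_self)
  qed
  finally show "fps_nth (part_series w i * (1 - q ^ i)) k
      = fps_nth (part_series (\<lambda>f. w f - (if f = 0 then 0 else w (f - 1))) i) k" .
qed

lemma part_series_single: "i > 0 \<Longrightarrow> part_series (\<lambda>f. of_bool (f = c)) i = q ^ (i * c)"
  by (auto simp: fps_eq_iff part_series_def elim!: dvdE)

lemma part_series_add: "part_series (\<lambda>f. u f + v f) i = part_series u i + part_series v i"
  by (simp add: fps_eq_iff part_series_def)

lemma part_series_cmult: "part_series (\<lambda>f. c * u f) i = fps_const c * part_series u i"
  by (simp add: fps_eq_iff part_series_def)

definition multisets_of_weight :: "nat set \<Rightarrow> nat \<Rightarrow> nat multiset set" where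
  "multisets_of_weight A N = {p. set_mset p \<subseteq> A \<and> sum_mset p = N}"

text \<open>Splitting off the copies of i mirrors the Cauchy product in the induction of
  \<open>nth_prod_part_series\<close>.\<close>

lemma bij_insert_part:
  assumes "i \<notin> A" and "i > 0"
  shows "bij_betw (\<lambda>(f, p). replicate_mset f i + p)
    (SIGMA f:{f. i * f \<le> N}. multisets_of_weight A (N - i * f))
    (multisets_of_weight (insert i A) N)"
proof (rule bij_betw_byWitness[where f' = "\<lambda>p. (count p i, filter_mset (\<lambda>x. x \<noteq> i) p)"])
  have *: "replicate_mset (count p i) i + filter_mset (\<lambda>x. x \<noteq> i) p = p" for p
    by (rule multiset_eqI) auto
  then show "\<forall>p\<in>multisets_of_weight (insert i A) N.
      (case (count p i, filter_mset (\<lambda>x. x \<noteq> i) p) of (f, p) \<Rightarrow> replicate_mset f i + p) = p"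
    by simp
  have "i * count p i + sum_mset (filter_mset (\<lambda>x. x \<noteq> i) p) = sum_mset p" for p
    using arg_cong[OF *[of p], of sum_mset] by (simp add: mult.commute)
  then show "(\<lambda>p. (count p i, filter_mset (\<lambda>x. x \<noteq> i) p)) ` multisets_of_weight (insert i A) N
      \<subseteq> (SIGMA f:{f. i * f \<le> N}. multisets_of_weight A (N - i * f))"
    unfolding multisets_of_weight_def by (auto simp: le_add1) (metis le_add1, metis add_diff_cancel_left')
  show "\<forall>x\<in>SIGMA f:{f. i * f \<le> N}. multisets_of_weight A (N - i * f).
      (\<lambda>p. (count p i, filter_mset (\<lambda>x. x \<noteq> i) p)) (case x of (f, p) \<Rightarrow> replicate_mset f i + p) = x"
  proof clarify
    fix f p assume "p \<in> multisets_of_weight A (N - i * f)"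
    then have "i \<notin># p" using assms by (auto simp: multisets_of_weight_def)
    then show "count (replicate_mset f i + p) i = f \<and> filter_mset (\<lambda>x. x \<noteq> i) (replicate_mset f i + p) = p"
      by (auto simp: not_in_iff intro!: multiset_eqI)
  qed
  show "(\<lambda>(f, p). replicate_mset f i + p) ` (SIGMA f:{f. i * f \<le> N}. multisets_of_weight A (N - i * f))
      \<subseteq> multisets_of_weight (insert i A) N"
    by (auto simp: multisets_of_weight_def mult.commute split: if_splits)
qed

lemma finite_multisets_of_weight:
  assumes "0 \<notin> A"
  shows "finite (multisets_of_weight A N)"
  by (rule finite_subset[OF _ finite_partitions[of N]])
    (use assms in \<open>auto simp: multisets_of_weight_def is_partition_def intro!: gr0I\<close>)

lemma nth_prod_part_series:
  assumes "finite A" and "0 \<notin> A"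
  shows "fps_nth (\<Prod>i\<in>A. part_series (w i) i) N
    = (\<Sum>p\<in>multisets_of_weight A N. \<Prod>i\<in>A. w i (count p i))"
  using assms
proof (induction A arbitrary: N rule: finite_induct)
  case empty
  have "multisets_of_weight {} N = (if N = 0 then {{#}} else {})"
    by (auto simp: multisets_of_weight_def)
  then show ?case by simp
next
  case (insert i A)
  then have i: "i > 0" and A: "0 \<notin> A" by auto
  let ?W = "\<lambda>p. \<Prod>j\<in>A. w j (count p j)"
  have "fps_nth (\<Prod>j\<in>insert i A. part_series (w j) j) N
      = (\<Sum>k=0..N. fps_nth (part_series (w i) i) k * (\<Sum>p\<in>multisets_of_weight A (N - k). ?W p))"
    using insert A by (simp add: fps_mult_nth)
  also have "\<dots> = (\<Sum>f\<in>{f. i * f \<le> N}. w i f * (\<Sum>p\<in>multisets_of_weight A (N - i * f). ?W p))"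
  proof -
    have "(\<Sum>k=0..N. fps_nth (part_series (w i) i) k * (\<Sum>p\<in>multisets_of_weight A (N - k). ?W p))
        = (\<Sum>k\<in>{k\<in>{0..N}. i dvd k}. w i (k div i) * (\<Sum>p\<in>multisets_of_weight A (N - k). ?W p))"
      by (rule sum.mono_neutral_cong_right) (auto simp: part_series_def)
    also have "\<dots> = (\<Sum>f\<in>{f. i * f \<le> N}. w i f * (\<Sum>p\<in>multisets_of_weight A (N - i * f). ?W p))"
      by (rule sum.reindex_bij_witness[of _ "\<lambda>f. i * f" "\<lambda>k. k div i"]) (use i in auto)
    finally show ?thesis .
  qed
  also have "\<dots> = (\<Sum>(f, p)\<in>(SIGMA f:{f. i * f \<le> N}. multisets_of_weight A (N - i * f)). w i f * ?W p)"
  proof -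
    have "{f. i * f \<le> N} \<subseteq> {..N}"
      using i by (auto intro: order_trans[rotated])
    then have "finite {f. i * f \<le> N}" by (rule finite_subset) simp
    then show ?thesis
      unfolding sum_distrib_left by (subst sum.Sigma) (auto simp: finite_multisets_of_weight[OF A])
  qed
  also have "\<dots> = (\<Sum>p\<in>multisets_of_weight (insert i A) N. \<Prod>j\<in>insert i A. w j (count p j))"
  proof (rule sum.reindex_bij_betw[OF bij_insert_part[OF \<open>i \<notin> A\<close> i], THEN trans[rotated]])
    show "(\<Sum>(f, p)\<in>(SIGMA f:{f. i * f \<le> N}. multisets_of_weight A (N - i * f)). w i f * ?W p)
      = (\<Sum>x\<in>(SIGMA f:{f. i * f \<le> N}. multisets_of_weight A (N - i * f)).
          \<Prod>j\<in>insert i A. w j (count (case x of (f, p) \<Rightarrow> replicate_mset f i + p) j))"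
    proof (rule sum.cong[OF refl])
      fix x assume x: "x \<in> (SIGMA f:{f. i * f \<le> N}. multisets_of_weight A (N - i * f))"
      obtain f p where [simp]: "x = (f, p)" by (cases x)
      have "i \<notin># p" using x \<open>i \<notin> A\<close> by (auto simp: multisets_of_weight_def)
      moreover have "?W (replicate_mset f i + p) = ?W p"
        by (rule prod.cong[OF refl]) (use \<open>i \<notin> A\<close> in auto)
      ultimately show "(case x of (f, p) \<Rightarrow> w i f * ?W p)
          = (\<Prod>j\<in>insert i A. w j (count (case x of (f, p) \<Rightarrow> replicate_mset f i + p) j))"
        using insert.hyps by (simp add: not_in_iff)
    qed
  qed
  finally show ?case .
qed

subsection \<open>The two generating functions\<close>

lemma part_series_const: "i > 0 \<Longrightarrow> part_series (\<lambda>_. 1) i = geo i"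
proof -
  assume i: "i > 0"
  have "(\<lambda>f. (1::rat) - (if f = 0 then 0 else 1)) = (\<lambda>f. of_bool (f = (0::nat)))"
    by auto
  then have "part_series (\<lambda>_. 1) i * (1 - q ^ i) = 1"
    using part_series_mult[OF i, of "\<lambda>_. 1"] part_series_single[OF i, of 0] by simp
  from eq_geo_multI[OF i this] show ?thesis by simp
qed

lemma part_series_overpartition:
  assumes i: "i > 0"
  shows "part_series (\<lambda>f. if f = 0 then 1 else 2) i = (1 + q ^ i) * geo i"
proof (rule eq_geo_multI[OF i])
  have "(\<lambda>f::nat. (if f = 0 then 1 else 2) - (if f = 0 then 0 else if f - 1 = 0 then 1 else 2 :: rat))
      = (\<lambda>f. of_bool (f = 0) + of_bool (f = 1))"
    by auto
  then show "part_series (\<lambda>f. if f = 0 then 1 else 2) i * (1 - q ^ i) = 1 + q ^ i"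
    using part_series_single[OF i, of 0] part_series_single[OF i, of 1]
    by (simp only: part_series_mult[OF i] part_series_add) simp
qed

section \<open>The elements of R with fixed n\<close>

text \<open>The factor that \<open>f\<close> copies of the part \<open>i\<close> contribute to \<open>\<mu>\<close> when \<open>n(\<pi>) = n\<close>. It is \<open>0\<close> exactly
  when the multiplicity is forbidden by the definition of \<open>\<R>\<close>.\<close>

definition R_weight :: "nat \<Rightarrow> nat \<Rightarrow> nat \<Rightarrow> nat" where
  "R_weight n i f =
     (if even i
      then if i < n then (if f = 0 then 0 else if f = 1 then 1 else 2)
           else if i = n then (if f < 2 then 0 else 2)
           else of_bool (f = 1)
      else if i < n then 2 * f + 1
      else if i = n then 2 * f
      else 1)"

text \<open>The first factor depends on the parity of i, the second on the position of i relative to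
  n but not on parity. So the product over i separates into q^(n (n - 1)) / (q; q^2)_n and a product
  over i up to n.\<close>

lemma part_series_R_weight:
  assumes i: "i > 0"
  shows "part_series (\<lambda>f. of_nat (R_weight n i f)) i
    = (if even i then q ^ i else geo i)
      * (if i < n then (1 + q ^ i) * geo i else if i = n then 2 * q ^ n * geo n else 1)"
proof -
  note single = part_series_single[OF i]
  consider "even i" "i < n" | "even i" "i = n" | "even i" "i > n"
    | "odd i" "i < n" | "odd i" "i = n" | "odd i" "i > n"
    by linarith
  then show ?thesis
  proof cases
    case 1
    have "part_series (\<lambda>f. if f = 0 then 0 else if f = 1 then 1 else 2) i = (q ^ i + q ^ (i * 2)) * geo i"
    proof (rule eq_geo_multI[OF i])
      have "(\<lambda>f::nat. (if f = 0 then 0 else if f = 1 then 1 else 2)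
          - (if f = 0 then 0 else if f - 1 = 0 then 0 else if f - 1 = 1 then 1 else 2 :: rat))
          = (\<lambda>f. of_bool (f = 1) + of_bool (f = 2))"
        by (rule ext) auto
      then show "part_series (\<lambda>f. if f = 0 then 0 else if f = 1 then 1 else 2) i * (1 - q ^ i)
          = q ^ i + q ^ (i * 2)"
        by (simp only: part_series_mult[OF i] part_series_add single mult_1_right)
    qed
    moreover have "(\<lambda>f. of_nat (R_weight n i f)) = (\<lambda>f. if f = 0 then 0 else if f = 1 then 1 else 2 :: rat)"
      using 1 by (auto simp: R_weight_def)
    ultimately show ?thesis
      using 1 by (simp add: algebra_simps power_mult power2_eq_square)
  next
    case 2
    have "part_series (\<lambda>f. if f < 2 then 0 else 2) i = (2 * q ^ (i * 2)) * geo i"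
    proof (rule eq_geo_multI[OF i])
      have "(\<lambda>f. (if f < 2 then 0 else 2) - (if f = 0 then 0 else if f - 1 < 2 then 0 else 2 :: rat))
          = (\<lambda>f. 2 * of_bool (f = (2::nat)))"
        by (rule ext) auto
      then show "part_series (\<lambda>f. if f < 2 then 0 else 2) i * (1 - q ^ i) = 2 * q ^ (i * 2)"
        by (simp only: part_series_mult[OF i] part_series_cmult single)
          (simp add: numeral_fps_const)
    qed
    moreover have "(\<lambda>f. of_nat (R_weight n i f)) = (\<lambda>f. if f < 2 then 0 else 2 :: rat)"
      using 2 by (auto simp: R_weight_def)
    ultimately show ?thesis
      using 2 by (simp add: algebra_simps power_mult power2_eq_square)
  next
    case 3
    then have "(\<lambda>f. of_nat (R_weight n i f)) = (\<lambda>f. of_bool (f = 1) :: rat)"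
      by (auto simp: R_weight_def)
    then show ?thesis using 3 single[of 1] by simp
  next
    case 4
    \<comment> \<open>The differences 1, 2, 2, ... of 2 f + 1 are the overpartition weights, whose
      series is known.\<close>
    have "part_series (\<lambda>f. 2 * of_nat f + 1) i = (1 + q ^ i) * geo i * geo i"
    proof (rule eq_geo_multI[OF i])
      have "(\<lambda>f. (2 * of_nat f + 1) - (if f = 0 then 0 else 2 * of_nat (f - 1) + 1 :: rat))
          = (\<lambda>f. if f = 0 then 1 else 2)"
        by (auto simp: of_nat_diff)
      then show "part_series (\<lambda>f. 2 * of_nat f + 1) i * (1 - q ^ i) = (1 + q ^ i) * geo i"
        by (simp only: part_series_mult[OF i] part_series_overpartition[OF i])
    qed
    moreover have "(\<lambda>f. of_nat (R_weight n i f)) = (\<lambda>f. 2 * of_nat f + 1 :: rat)"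
      using 4 by (auto simp: R_weight_def)
    ultimately show ?thesis
      using 4 by (simp add: mult_ac)
  next
    case 5
    have "part_series (\<lambda>f. if f = 0 then 0 else 2) i = (2 * q ^ i) * geo i"
    proof (rule eq_geo_multI[OF i])
      have "(\<lambda>f. (if f = 0 then 0 else 2) - (if f = 0 then 0 else if f - 1 = 0 then 0 else 2 :: rat))
          = (\<lambda>f. 2 * of_bool (f = (1::nat)))"
        by (rule ext) auto
      then show "part_series (\<lambda>f. if f = 0 then 0 else 2) i * (1 - q ^ i) = 2 * q ^ i"
        by (simp only: part_series_mult[OF i] part_series_cmult single)
          (simp add: numeral_fps_const)
    qed
    note aux = this
    have "part_series (\<lambda>f. 2 * of_nat f) i = (2 * q ^ i) * geo i * geo i"
    proof (rule eq_geo_multI[OF i])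
      have "(\<lambda>f. 2 * of_nat f - (if f = 0 then 0 else 2 * of_nat (f - 1) :: rat))
          = (\<lambda>f. if f = 0 then 0 else 2)"
        by (auto simp: of_nat_diff)
      then show "part_series (\<lambda>f. 2 * of_nat f) i * (1 - q ^ i) = (2 * q ^ i) * geo i"
        by (simp only: part_series_mult[OF i] aux)
    qed
    moreover have "(\<lambda>f. of_nat (R_weight n i f)) = (\<lambda>f. 2 * of_nat f :: rat)"
      using 5 by (auto simp: R_weight_def)
    ultimately show ?thesis
      using 5 by (simp add: mult_ac)
  next
    case 6
    then have "(\<lambda>f. of_nat (R_weight n i f)) = (\<lambda>f. 1 :: rat)"
      by (auto simp: R_weight_def)
    then show ?thesis using 6 part_series_const[OF i] by simp
  qed
qed

lemma prod_odd_even_split: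
  fixes g :: "nat \<Rightarrow> 'a :: comm_monoid_mult"
  shows "(\<Prod>i=1..2 * Suc m - 1. g i) = (\<Prod>j\<in>{1..<Suc m}. g (2 * j)) * (\<Prod>j<Suc m. g (2 * j + 1))"
proof (induction m)
  case (Suc m)
  have "2 * Suc (Suc m) - 1 = Suc (Suc (2 * Suc m - 1))" by simp
  then have "(\<Prod>i=1..2 * Suc (Suc m) - 1. g i)
      = (\<Prod>i=1..2 * Suc m - 1. g i) * g (2 * Suc m) * g (2 * Suc m + 1)"
    by simp
  then show ?case unfolding Suc.IH by (simp add: mult_ac)
qed simp

lemma geo_double: "j > 0 \<Longrightarrow> geo (2 * j) * (1 + q ^ j) = geo j"
proof -
  assume j: "j > 0"
  have "geo (2 * j) * (1 + q ^ j) * (1 - q ^ j) = geo (2 * j) * (1 - q ^ (2 * j))"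
    unfolding mult_2 power_add by (simp add: algebra_simps)
  also have "\<dots> = 1" using j by (intro geo_cancel) simp
  finally show ?thesis using eq_geo_multI[OF j, of _ 1] by simp
qed

text \<open>Of the 2 n denominators the odd ones stay, and each even one absorbs a factor, as 1 -
  q^(2 k) = (1 - q^k) (1 + q^k).\<close>

lemma qfac_inv_double:
  "qfac_inv 1 (2 * n) * (\<Prod>k<n. 1 + q ^ Suc k) = (\<Prod>k<n. geo (2 * k + 1)) * (\<Prod>k<n. geo (Suc k))"
proof (induction n)
  case (Suc n)
  have "2 * Suc n = Suc (Suc (2 * n))" by simp
  then have "qfac_inv 1 (2 * Suc n) = qfac_inv 1 (2 * n) * geo (2 * n + 1) * geo (2 * Suc n)"
    by (simp add: qfac_inv_Suc)
  then have "qfac_inv 1 (2 * Suc n) * (\<Prod>k<Suc n. 1 + q ^ Suc k)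
      = (qfac_inv 1 (2 * n) * (\<Prod>k<n. 1 + q ^ Suc k)) * geo (2 * n + 1)
        * (geo (2 * Suc n) * (1 + q ^ Suc n))"
    by (simp only: prod.lessThan_Suc mult_ac)
  also have "geo (2 * Suc n) * (1 + q ^ Suc n) = geo (Suc n)"
    by (rule geo_double) simp
  finally show ?case unfolding Suc.IH by (simp add: mult_ac)
qed simp

lemma bailey_term_eq_prod_part_series:
  assumes "n > 0"
  shows "bailey_term n = (\<Prod>i=1..2 * n - 1. part_series (\<lambda>f. of_nat (R_weight n i f)) i)"
proof -
  obtain m where m: "n = Suc m" using assms by (cases n) auto
  let ?B = "\<lambda>i. if i < n then (1 + q ^ i) * geo i else if i = n then 2 * q ^ n * geo n else 1"
  have "(\<Prod>i=1..2 * n - 1. part_series (\<lambda>f. of_nat (R_weight n i f)) i)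
      = (\<Prod>i=1..2 * n - 1. if even i then q ^ i else geo i) * (\<Prod>i=1..2 * n - 1. ?B i)"
    unfolding prod.distrib[symmetric] by (intro prod.cong part_series_R_weight) auto
  also have "(\<Prod>i=1..2 * n - 1. if even i then q ^ i else geo i)
      = q ^ (n * m) * (\<Prod>k<n. geo (2 * k + 1))"
  proof -
    \<comment> \<open>The obligatory even parts 2, 4, ..., 2 m have total weight m (m + 1).\<close>
    have pow: "(\<Prod>j\<in>{1..<Suc m}. q ^ (2 * j)) = q ^ (Suc m * m)"
    proof (induction m)
      case (Suc m)
      have "(\<Prod>j\<in>{1..<Suc (Suc m)}. q ^ (2 * j)) = (\<Prod>j\<in>{1..<Suc m}. q ^ (2 * j)) * q ^ (2 * Suc m)"
        by (rule prod.atLeastLessThan_Suc) simp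
      moreover have "Suc (Suc m) * Suc m = Suc m * m + 2 * Suc m" by simp
      ultimately show ?case unfolding Suc.IH by (simp only: power_add)
    qed simp
    have "(\<Prod>j\<in>{1..<Suc m}. if even (2 * j) then q ^ (2 * j) else geo (2 * j))
        = (\<Prod>j\<in>{1..<Suc m}. q ^ (2 * j))"
      by (rule prod.cong) auto
    moreover have "(\<Prod>j<Suc m. if even (2 * j + 1) then q ^ (2 * j + 1) else geo (2 * j + 1))
        = (\<Prod>j<Suc m. geo (2 * j + 1))"
      by (rule prod.cong) auto
    ultimately show ?thesis unfolding m prod_odd_even_split pow by (simp only:)
  qed
  also have "(\<Prod>i=1..2 * n - 1. ?B i) = (\<Prod>i=1..n. ?B i)"
    by (rule prod.mono_neutral_cong_right) (use m in auto)
  also have "\<dots> = (\<Prod>i=1..m. (1 + q ^ i) * geo i) * (2 * q ^ n * geo n)"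
    unfolding m by (simp add: prod.nat_ivl_Suc')
  also have "(\<Prod>i=1..m. (1 + q ^ i) * geo i) = (\<Prod>k<m. 1 + q ^ Suc k) * (\<Prod>k<m. geo (Suc k))"
    unfolding prod.distrib[symmetric]
    by (rule prod.reindex_bij_witness[of _ Suc "\<lambda>k. k - 1"]) auto
  finally have R: "(\<Prod>i=1..2 * n - 1. part_series (\<lambda>f. of_nat (R_weight n i f)) i)
      = q ^ (n * m) * (\<Prod>k<n. geo (2 * k + 1))
        * ((\<Prod>k<m. 1 + q ^ Suc k) * (\<Prod>k<m. geo (Suc k)) * (2 * q ^ n * geo n))" .
  have "bailey_term n = q ^ n\<^sup>2 * ((qfac_inv 1 (2 * n) * (\<Prod>k<n. 1 + q ^ Suc k)) * (\<Prod>k<n. 1 + q ^ k))"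
  proof -
    have "theta_sum 1 q 1 n n
        = qfac_inv 1 (n + n) * (\<Prod>k<n. 1 + q * q ^ (1 * k)) * (\<Prod>k<n. 1 + 1 * q ^ (1 * k))"
      by (rule finite_jacobi_triple) auto
    then show ?thesis by (simp only: bailey_term_def mult_2 mult_1 power_Suc)
  qed
  \<comment> \<open>The factor for k = 0 is 1 + 1; this 2 matches the one contributed by the part
    n.\<close>
  also have "(\<Prod>k<n. 1 + q ^ k) = 2 * (\<Prod>k<m. 1 + q ^ Suc k)"
    unfolding m prod.lessThan_Suc_shift by simp
  also note qfac_inv_double
  also have "(\<Prod>k<n. geo (Suc k)) = (\<Prod>k<m. geo (Suc k)) * geo n"
    unfolding m by simp
  finally have L: "bailey_term n = q ^ n\<^sup>2 * ((\<Prod>k<n. geo (2 * k + 1))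
      * ((\<Prod>k<m. geo (Suc k)) * geo n) * (2 * (\<Prod>k<m. 1 + q ^ Suc k)))" .
  have "n\<^sup>2 = n * m + n" by (simp add: m power2_eq_square)
  then have "q ^ n\<^sup>2 = q ^ (n * m) * q ^ n" by (simp only: power_add)
  then show ?thesis unfolding L R by (simp only: mult_ac)
qed

text \<open>Even parts account for 2^delta and odd parts for gamma. For even n the part n occurs at
  least twice, so its weight 2 belongs to 2^delta.\<close>

lemma mu_eq_prod_R_weight:
  assumes R: "R_index p n"
  shows "mu p = (\<Prod>i=1..2 * n - 1. R_weight n i (count p i))"
proof -
  obtain m where m: "n = Suc m" using R by (cases n) (auto simp: R_index_def)
  have "2 ^ delta p = (\<Prod>j\<in>{1..<n}. 2 ^ of_bool (count p (2 * j) > 1) :: nat)"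
    by (simp only: delta_def n_of_eq[OF R] power_sum)
  also have "\<dots> = (\<Prod>j\<in>{1..<n}. R_weight n (2 * j) (count p (2 * j)))"
  proof (rule prod.cong[OF refl])
    fix j assume j: "j \<in> {1..<n}"
    then have "2 * j > 0 \<and> even (2 * j) \<and> 2 * j \<le> 2 * n - 2" by auto
    then have "2 * j \<in># p" using R unfolding R_index_def by blast
    then obtain c where c: "count p (2 * j) = Suc c"
      by (metis count_eq_zero_iff not0_implies_Suc)
    show "2 ^ of_bool (count p (2 * j) > 1) = R_weight n (2 * j) (count p (2 * j))"
    proof (cases "2 * j > n")
      case True
      then have "count p (2 * j) \<le> 1" using R by (simp add: R_index_def)
      with c have "count p (2 * j) = 1" by linarith
      then show ?thesis using True by (simp add: R_weight_def)
    next
      case False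
      moreover have "c \<noteq> 0" if "2 * j = n"
        using R that c by (auto simp: R_index_def)
      ultimately show ?thesis using c by (auto simp: R_weight_def)
    qed
  qed
  finally have even: "2 ^ delta p = (\<Prod>j\<in>{1..<n}. R_weight n (2 * j) (count p (2 * j)))" .
  have "(\<Prod>j<n. R_weight n (2 * j + 1) (count p (2 * j + 1)))
      = (\<Prod>j\<in>{j. 2 * j + 1 < n}. R_weight n (2 * j + 1) (count p (2 * j + 1)))
        * (\<Prod>j\<in>{j. 2 * j + 1 = n}. R_weight n (2 * j + 1) (count p (2 * j + 1)))"
  proof -
    have fin: "finite {j. 2 * j + 1 < n}" "finite {j. 2 * j + 1 = n}"
      by (rule finite_subset[of _ "{..<n}"]; auto)+
    show ?thesis
      by (subst prod.union_disjoint[OF fin, symmetric])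
        (auto simp: R_weight_def intro!: prod.mono_neutral_right split: if_splits)
  qed
  also have "(\<Prod>j\<in>{j. 2 * j + 1 < n}. R_weight n (2 * j + 1) (count p (2 * j + 1)))
      = (\<Prod>j\<in>{j. 2 * j + 1 < n}. 2 * count p (2 * j + 1) + 1)"
    by (rule prod.cong) (auto simp: R_weight_def)
  also have "(\<Prod>j\<in>{j. 2 * j + 1 = n}. R_weight n (2 * j + 1) (count p (2 * j + 1)))
      = of_bool (even n) + 2 * count p n * of_bool (odd n)"
  proof (cases "even n")
    case True
    then have "{j. 2 * j + 1 = n} = {}" by auto
    then show ?thesis using True by simp
  next
    case False
    then obtain k where "n = 2 * k + 1" by (blast elim: oddE)
    then have "{j. 2 * j + 1 = n} = {k}" "n = 2 * k + 1" by auto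
    then show ?thesis by (simp add: R_weight_def)
  qed
  finally have odd: "(\<Prod>j<n. R_weight n (2 * j + 1) (count p (2 * j + 1))) = gamma p"
    by (simp add: gamma_def n_of_eq[OF R])
  show ?thesis
    using even odd unfolding mu_def m prod_odd_even_split by simp
qed

text \<open>This restricts the sum over all multisets with parts up to 2 n - 1 to those of index n:
  any other one has a factor 0.\<close>

lemma R_index_if_prod_R_weight:
  assumes n: "n > 0" and p: "set_mset p \<subseteq> {1..2 * n - 1}"
    and nz: "(\<Prod>i=1..2 * n - 1. R_weight n i (count p i)) \<noteq> 0"
  shows "R_index p n"
proof -
  have w: "R_weight n i (count p i) \<noteq> 0" if "1 \<le> i" "i \<le> 2 * n - 1" for i
    using nz that by (auto simp: prod_zero_iff)
  have "i \<in># p" if "i > 0" "even i" "i \<le> 2 * n - 2" for i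
  proof (rule count_inI)
    assume "count p i = 0"
    then have "R_weight n i (count p i) = 0" using that by (simp add: R_weight_def)
    then show False using w[of i] that by simp
  qed
  moreover have "count p n \<ge> 1 + of_bool (even n)"
  proof -
    have "R_weight n n (count p n) \<noteq> 0" using w[of n] n by simp
    then show ?thesis by (auto simp: R_weight_def split: if_splits)
  qed
  moreover have "count p i \<le> 1" if "even i" "i > n" for i
  proof (cases "i \<le> 2 * n - 1")
    case True
    then show ?thesis using w[of i] that by (auto simp: R_weight_def split: if_splits)
  next
    case False
    then have "i \<notin># p" using p by auto
    then show ?thesis by (simp add: not_in_iff)
  qed
  ultimately show ?thesis using n p by (auto simp: R_index_def)
qed

lemma nth_bailey_term:
  assumes n: "n > 0"
  shows "fps_nth (bailey_term n) N
    = of_nat (\<Sum>p\<in>{p. is_partition p \<and> R_index p n \<and> sum_mset p = N}. mu p)"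
proof -
  let ?A = "{1..2 * n - 1}"
  have "fps_nth (bailey_term n) N
      = of_nat (\<Sum>p\<in>multisets_of_weight ?A N. \<Prod>i\<in>?A. R_weight n i (count p i))"
    unfolding bailey_term_eq_prod_part_series[OF n] by (subst nth_prod_part_series) auto
  also have "(\<Sum>p\<in>multisets_of_weight ?A N. \<Prod>i\<in>?A. R_weight n i (count p i))
      = (\<Sum>p\<in>{p. is_partition p \<and> R_index p n \<and> sum_mset p = N}. mu p)"
  proof (rule sum.mono_neutral_cong_right)
    show "finite (multisets_of_weight ?A N)" by (rule finite_multisets_of_weight) simp
    show "{p. is_partition p \<and> R_index p n \<and> sum_mset p = N} \<subseteq> multisets_of_weight ?A N"
      by (auto simp: multisets_of_weight_def R_index_def is_partition_def Suc_le_eq)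
    show "\<forall>p\<in>multisets_of_weight ?A N - {p. is_partition p \<and> R_index p n \<and> sum_mset p = N}.
        (\<Prod>i\<in>?A. R_weight n i (count p i)) = 0"
    proof
      fix p assume p: "p \<in> multisets_of_weight ?A N - {p. is_partition p \<and> R_index p n \<and> sum_mset p = N}"
      then have A: "set_mset p \<subseteq> ?A" and "sum_mset p = N"
        by (auto simp: multisets_of_weight_def)
      moreover have "is_partition p" using A by (auto simp: is_partition_def)
      ultimately have "\<not> R_index p n" using p by blast
      then show "(\<Prod>i\<in>?A. R_weight n i (count p i)) = 0"
        using R_index_if_prod_R_weight[OF n A] by blast
    qed
  qed (use mu_eq_prod_R_weight in auto)
  finally show ?thesis .
qed

lemma sum_mu_eq_nth:
  assumes "N > 0"
  shows "of_nat (\<Sum>p\<in>{p \<in> R_set. sum_mset p = N}. mu p) = fps_nth (\<Sum>n\<le>N. bailey_term n) N"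
proof -
  let ?R = "\<lambda>n. {p. is_partition p \<and> R_index p n \<and> sum_mset p = N}"
  have "{p \<in> R_set. sum_mset p = N} = (\<Union>n\<in>{1..N}. ?R n)"
  proof -
    \<comment> \<open>By the lower bound on its multiplicity n is itself a part, hence at most
      N.\<close>
    have "n \<in> {1..N}" if "R_index p n" "sum_mset p = N" for p n
    proof -
      have "n \<in># p" using that by (intro count_inI) (auto simp: R_index_def)
      then obtain p' where "p = add_mset n p'" by (meson multi_member_split)
      then show ?thesis using that by (auto simp: R_index_def)
    qed
    then show ?thesis unfolding R_set_def by blast
  qed
  also have "(\<Sum>p\<in>(\<Union>n\<in>{1..N}. ?R n). mu p) = (\<Sum>n=1..N. \<Sum>p\<in>?R n. mu p)"
  proof (rule sum.UNION_disjoint)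
    show "\<forall>n\<in>{1..N}. finite (?R n)"
      by (auto intro: finite_subset[OF _ finite_partitions[of N]])
    show "\<forall>m\<in>{1..N}. \<forall>n\<in>{1..N}. m \<noteq> n \<longrightarrow> ?R m \<inter> ?R n = {}"
      using R_index_unique by auto
  qed simp
  finally have "of_nat (\<Sum>p\<in>{p \<in> R_set. sum_mset p = N}. mu p) = (\<Sum>n=1..N. fps_nth (bailey_term n) N)"
    by (simp add: nth_bailey_term)
  also have "\<dots> = (\<Sum>n\<le>N. fps_nth (bailey_term n) N)"
  proof (rule sum.mono_neutral_left)
    \<comment> \<open>The term n = 0 counts no element of R, but being constant it does not affect
      the coefficient at N > 0.\<close>
    have "bailey_term 0 = 1"
      by (simp add: bailey_term_def theta_sum_def theta_term_def qfac_inv_int_def)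
    then show "\<forall>n\<in>{..N} - {1..N}. fps_nth (bailey_term n) N = 0"
      using assms by (auto simp: not_le)
  qed auto
  finally show ?thesis by (simp add: fps_sum_nth)
qed

section \<open>The generating function of C-tilde\<close>

definition C_weight :: "nat \<Rightarrow> nat \<Rightarrow> nat" where
  "C_weight i f = (if f = 0 then 1 else if 3 dvd i then 0 else 2)"

lemma part_series_C_weight:
  assumes "i > 0"
  shows "part_series (\<lambda>f. of_nat (C_weight i f)) i = overpartition_factor i"
proof (cases "3 dvd i")
  case True
  then have "(\<lambda>f. of_nat (C_weight i f)) = (\<lambda>f. of_bool (f = 0) :: rat)"
    by (auto simp: C_weight_def)
  then show ?thesis using True part_series_single[OF assms, of 0] by (simp add: overpartition_factor_def)
next
  case False
  then have "(\<lambda>f. of_nat (C_weight i f)) = (\<lambda>f. if f = 0 then 1 else 2 :: rat)"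
    by (auto simp: C_weight_def)
  then show ?thesis using False part_series_overpartition[OF assms] by (simp add: overpartition_factor_def)
qed

lemma prod_C_weight:
  assumes "finite A" and p: "set_mset p \<subseteq> A"
  shows "(\<Prod>i\<in>A. C_weight i (count p i)) = (if \<forall>i \<in># p. \<not> 3 dvd i then 2 ^ num_distinct p else 0)"
proof -
  have "(\<Prod>i\<in>A. C_weight i (count p i)) = (\<Prod>i\<in>set_mset p. C_weight i (count p i))"
    by (rule prod.mono_neutral_right) (use assms in \<open>auto simp: C_weight_def not_in_iff\<close>)
  also have "\<dots> = (\<Prod>i\<in>set_mset p. if 3 dvd i then 0 else 2)"
    by (rule prod.cong) (auto simp: C_weight_def count_eq_zero_iff)
  also have "\<dots> = (if \<forall>i \<in># p. \<not> 3 dvd i then 2 ^ num_distinct p else 0)"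
    by (auto simp: num_distinct_def prod_zero_iff)
  finally show ?thesis .
qed

lemma sum_C_tilde_eq_nth:
  assumes "N > 0"
  shows "of_nat (\<Sum>p\<in>{p \<in> C_tilde. sum_mset p = N}. 2 ^ num_distinct p)
    = fps_nth (\<Prod>i=1..3 * N. overpartition_factor i) N"
proof -
  let ?A = "{1..3 * N}"
  have "(\<Prod>i=1..3 * N. overpartition_factor i) = (\<Prod>i=1..3 * N. part_series (\<lambda>f. of_nat (C_weight i f)) i)"
    by (intro prod.cong) (auto simp: part_series_C_weight)
  then have "fps_nth (\<Prod>i=1..3 * N. overpartition_factor i) N
      = of_nat (\<Sum>p\<in>multisets_of_weight ?A N. \<Prod>i\<in>?A. C_weight i (count p i))"
    by (subst \<open>_ = _\<close>, subst nth_prod_part_series) auto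
  also have "(\<Sum>p\<in>multisets_of_weight ?A N. \<Prod>i\<in>?A. C_weight i (count p i))
      = (\<Sum>p\<in>{p \<in> C_tilde. sum_mset p = N}. 2 ^ num_distinct p)"
  proof (rule sum.mono_neutral_cong_right)
    show "finite (multisets_of_weight ?A N)" by (rule finite_multisets_of_weight) simp
    \<comment> \<open>Parts never exceed N, so the range up to 3 N, inherited from the product in
      base q^3, loses no partition.\<close>
    have "i \<le> 3 * sum_mset p" if "i \<in># p" for i and p :: "nat multiset"
      using that by (auto dest!: multi_member_split)
    then show sub: "{p \<in> C_tilde. sum_mset p = N} \<subseteq> multisets_of_weight ?A N"
      by (auto simp: C_tilde_def multisets_of_weight_def is_partition_def Suc_le_eq)
    show "\<forall>p\<in>multisets_of_weight ?A N - {p \<in> C_tilde. sum_mset p = N}.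
        (\<Prod>i\<in>?A. C_weight i (count p i)) = 0"
    proof
      fix p assume p: "p \<in> multisets_of_weight ?A N - {p \<in> C_tilde. sum_mset p = N}"
      \<comment> \<open>Since N > 0 the multiset is non-empty, so only a multiple of 3 can keep it
        out of \<open>C_tilde\<close>.\<close>
      then have A: "set_mset p \<subseteq> ?A" and "\<not> (\<forall>i \<in># p. \<not> 3 dvd i)"
        using assms by (auto simp: C_tilde_def multisets_of_weight_def is_partition_def)
      then show "(\<Prod>i\<in>?A. C_weight i (count p i)) = 0"
        by (subst prod_C_weight) auto
    qed
    show "(\<Prod>i\<in>?A. C_weight i (count p i)) = 2 ^ num_distinct p"
      if "p \<in> {p \<in> C_tilde. sum_mset p = N}" for p
    proof -
      have "set_mset p \<subseteq> ?A" using sub that by (auto simp: multisets_of_weight_def)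
      then show ?thesis using that by (subst prod_C_weight) (auto simp: C_tilde_def)
    qed
  qed
  finally show ?thesis by simp
qed

theorem theorem6p2:
  fixes N :: nat
  assumes "N > 0"
  shows "(\<Sum>p\<in>{p \<in> C_tilde. sum_mset p = N}. 2 ^ num_distinct p)
       = (\<Sum>p\<in>{p \<in> R_set. sum_mset p = N}. mu p)"
proof -
  have "(of_nat (\<Sum>p\<in>{p \<in> C_tilde. sum_mset p = N}. 2 ^ num_distinct p) :: rat)
      = of_nat (\<Sum>p\<in>{p \<in> R_set. sum_mset p = N}. mu p)"
    unfolding sum_C_tilde_eq_nth[OF assms] sum_mu_eq_nth[OF assms]
    using fps_cong_nth[OF sum_bailey_term_cong_product[of N], of N] by simp
  then show ?thesis by (simp only: of_nat_eq_iff)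
qed

end
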